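(* Let $N\ge 1$ and let $R(X_1,\dots,X_N)$ be a continuous real function defined for $0\le X_i<\infty$ ($i=1,\dots,N$) such that: (i) for all integers $\alpha_1,\dots,\alpha_N\ge 0$, with $\alpha=\alpha_1+\cdots+\alpha_N$, the partial derivative $\frac{\partial^{\alpha}R}{\partial X_1^{\alpha_1}\cdots\partial X_N^{\alpha_N}}$ exists and is continuous; (ii) each such derivative $\frac{\partial^{\alpha}R}{\partial X_1^{\alpha_1}\cdots\partial X_N^{\alpha_N}}$ can be integrated with respect to a given $X_i$ while the other variables are held fixed; (iii) for each such derivative and each $i$ with $\alpha_i\ge 1$, the difference quotients $$\frac1h\left\{\frac{\partial^{\alpha-1}R}{\partial X_1^{\alpha_1}\cdots\partial X_i^{\alpha_i-1}\cdots\partial X_N^{\alpha_N}}(\dots,X_i+h,\dots)-\frac{\partial^{\alpha-1}R}{\partial X_1^{\alpha_1}\cdots\partial X_i^{\alpha_i-1}\cdots\partial X_N^{\alpha_N}}(\dots,X_i,\dots)\right\}$$ converge as $h\to0$ to $\frac{\partial^{\alpha}R}{\partial X_1^{\alpha_1}\cdots\partial X_N^{\alpha_N}}$ uniformly with respect to the variables $X_j$, $j\neq i$. Then $R$ can be decomposed, for $X_1,\dots,X_N\in[0,\infty)$, as $$R(X_1,\dots,X_N)=R(0,\dots,0)+\sum_{k=1}^{N}\ \sum_{1\le i_1<\cdots<i_k\le N}\int_0^\infty\!\!\cdots\int_0^\infty \frac{\partial^k R(0,\dots,0,\mu_{i_1},0,\dots,0,\mu_{i_k},0,\dots,0)}{\partial\mu_{i_1}\cdots\partial\mu_{i_k}}\,\sigma(X_{i_1}-\mu_{i_1})\cdots\sigma(X_{i_k}-\mu_{i_k})\,d\mu_{i_1}\cdots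 d\mu_{i_k},$$ where in the summand indexed by $i_1<\cdots<i_k$ the argument of $R$ has entry $\mu_{i_l}$ in position $i_l$ for $l=1,\dots,k$ and entry $0$ in every other position.
   Context: $\sigma$ is the Heaviside step function: for each $\mu_i\ge 0$, $\sigma(X_i-\mu_i)=1$ if $X_i>\mu_i$, $\sigma(X_i-\mu_i)=\tfrac12$ if $X_i=\mu_i$, and $\sigma(X_i-\mu_i)=0$ if $X_i<\mu_i$. The expression $\frac{\partial^k R(0,\dots,\mu_{i_1},\dots,\mu_{i_k},\dots,0)}{\partial\mu_{i_1}\cdots\partial\mu_{i_k}}$ denotes the mixed partial derivative, with respect to $\mu_{i_1},\dots,\mu_{i_k}$, of the function of $k$ variables obtained from $R$ by setting all variables other than those in positions $i_1,\dots,i_k$ equal to $0$. *)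

theory Defs
  imports "HOL-Analysis.Analysis"
begin

definition heaviside :: "real \<Rightarrow> real" where
  "heaviside x = (if x > 0 then 1 else if x = 0 then 1/2 else 0)"

definition orthant :: "(real ^ 'n) set" where
  "orthant = {X. \<forall>i. 0 \<le> X $ i}"

definition coord_upd :: "real ^ 'n \<Rightarrow> 'n \<Rightarrow> real \<Rightarrow> real ^ 'n" where
  "coord_upd X i t = (\<chi> j. if j = i then t else X $ j)"

definition restrict_coords :: "'n set \<Rightarrow> real ^ 'n \<Rightarrow> real ^ 'n" where
  "restrict_coords S X = (\<chi> j. if j \<in> S then X $ j else 0)"

(* Functions are total on real ^ 'n, but every derivative below is taken along [0,\<infinity>), hence is
   one-sided on the boundary of the orthant and, at points of the orthant, does not depend on
   values outside of it. *)

definition partial_deriv :: "'n \<Rightarrow> (real ^ 'n \<Rightarrow> real) \<Rightarrow> real ^ 'n \<Rightarrow> real" where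
  "partial_deriv i f X = vector_derivative (\<lambda>t. f (coord_upd X i t)) (at (X $ i) within {0..})"

definition partial_differentiable :: "'n \<Rightarrow> (real ^ 'n \<Rightarrow> real) \<Rightarrow> bool" where
  "partial_differentiable i f \<longleftrightarrow>
     (\<forall>X\<in>orthant. (\<lambda>t. f (coord_upd X i t)) differentiable (at (X $ i) within {0..}))"

(* The list [i1, ..., ik] stands for the operator d^k / (dX_i1 ... dX_ik), where the rightmost
   derivative is taken first. *)

primrec partial_derivs :: "'n list \<Rightarrow> (real ^ 'n \<Rightarrow> real) \<Rightarrow> real ^ 'n \<Rightarrow> real" where
  "partial_derivs [] f = f"
| "partial_derivs (i # is) f = partial_deriv i (partial_derivs is f)"

primrec partial_derivs_exist :: "'n list \<Rightarrow> (real ^ 'n \<Rightarrow> real) \<Rightarrow> bool" where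
  "partial_derivs_exist [] f \<longleftrightarrow> True"
| "partial_derivs_exist (i # is) f \<longleftrightarrow>
     partial_derivs_exist is f \<and> partial_differentiable i (partial_derivs is f)"

definition multi_index_list :: "('n::{finite,linorder} \<Rightarrow> nat) \<Rightarrow> 'n list" where
  "multi_index_list \<alpha> = concat (map (\<lambda>i. replicate (\<alpha> i) i) (sorted_list_of_set UNIV))"

abbreviation multi_deriv ::
    "('n::{finite,linorder} \<Rightarrow> nat) \<Rightarrow> (real ^ 'n::{finite,linorder} \<Rightarrow> real)
      \<Rightarrow> real ^ 'n::{finite,linorder} \<Rightarrow> real" where
  "multi_deriv \<alpha> \<equiv> partial_derivs (multi_index_list \<alpha>)"

abbreviation multi_deriv_exists ::
    "('n::{finite,linorder} \<Rightarrow> nat) \<Rightarrow> (real ^ 'n::{finite,linorder} \<Rightarrow> real) \<Rightarrow> bool" where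
  "multi_deriv_exists \<alpha> \<equiv> partial_derivs_exist (multi_index_list \<alpha>)"

(* Iterated integral over [0,\<infinity>) in the variables i1, ..., ik of the list, the integral over i1
   being the innermost one; the remaining coordinates are those of Y. *)

primrec iterated_integral :: "'n list \<Rightarrow> (real ^ 'n \<Rightarrow> real) \<Rightarrow> real ^ 'n \<Rightarrow> real" where
  "iterated_integral [] F Y = F Y"
| "iterated_integral (i # is) F Y =
     iterated_integral is (\<lambda>Z. integral {0..} (\<lambda>t. F (coord_upd Z i t))) Y"

(* Existence of all the integrals that occur in an iterated integral. *)

primrec iterated_integrable :: "'n list \<Rightarrow> (real ^ 'n \<Rightarrow> real) \<Rightarrow> bool" where
  "iterated_integrable [] F \<longleftrightarrow> True"
| "iterated_integrable (i # is) F \<longleftrightarrow>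
     (\<forall>Z\<in>orthant. (\<lambda>t. F (coord_upd Z i t)) integrable_on {0..}) \<and>
     iterated_integrable is (\<lambda>Z. integral {0..} (\<lambda>t. F (coord_upd Z i t)))"

(* The mixed derivative of the function of the variables in the list obtained from R by setting
   the other variables to 0, multiplied by the step functions. *)

definition step_integrand ::
    "(real ^ 'n \<Rightarrow> real) \<Rightarrow> 'n list \<Rightarrow> real ^ 'n \<Rightarrow> real ^ 'n \<Rightarrow> real" where
  "step_integrand R is X \<mu> =
     partial_derivs is (\<lambda>Y. R (restrict_coords (set is) Y)) \<mu> *
     (\<Prod>i\<leftarrow>is. heaviside (X $ i - \<mu> $ i))"

end

theory Submission
  imports Defs
begin

text \<open>By the fundamental theorem of calculus, integrating \<open>\<partial>\<^sub>i G\<close> against the step function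
  \<open>\<sigma>(X\<^sub>i - \<mu>\<^sub>i)\<close> gives the difference \<open>\<Delta>\<^sub>i G\<close> of the values of \<open>G\<close> at \<open>\<mu>\<^sub>i = X\<^sub>i\<close> and
  \<open>\<mu>\<^sub>i = 0\<close>. As \<open>\<Delta>\<^sub>i\<close> commutes with the derivatives in the other variables, the iterated integral
  over the variables in \<open>S\<close> is the iterated difference \<open>\<Delta>\<^sub>S R (0)\<close>. Substituting \<open>X\<^sub>i\<close> for
  \<open>\<mu>\<^sub>i\<close> is the operator \<open>\<Delta>\<^sub>i + Z\<^sub>i\<close>, where \<open>Z\<^sub>i\<close> substitutes 0, and the decomposition is the
  expansion of the product of these operators over all \<open>i\<close>, evaluated at 0.\<close>

section \<open>Coordinate substitution and one-sided partial derivatives\<close>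

lemma coord_upd_nth: "coord_upd X i t $ j = (if j = i then t else X $ j)"
  by (simp add: coord_upd_def)

lemma coord_upd_same [simp]: "coord_upd X i t $ i = t"
  by (simp add: coord_upd_nth)

lemma coord_upd_overwrite [simp]: "coord_upd (coord_upd X i s) i t = coord_upd X i t"
  by (simp add: vec_eq_iff coord_upd_nth)

lemma coord_upd_triv [simp]: "coord_upd X i (X $ i) = X"
  by (simp add: vec_eq_iff coord_upd_nth)

lemma coord_upd_commute:
  "i \<noteq> j \<Longrightarrow> coord_upd (coord_upd X i s) j t = coord_upd (coord_upd X j t) i s"
  by (auto simp: vec_eq_iff coord_upd_nth)

lemma coord_upd_orthant: "X \<in> orthant \<Longrightarrow> 0 \<le> t \<Longrightarrow> coord_upd X i t \<in> orthant"
  by (simp add: orthant_def coord_upd_nth)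

lemma restrict_coords_coord_upd:
  "i \<in> S \<Longrightarrow> restrict_coords S (coord_upd X i t) = coord_upd (restrict_coords S X) i t"
  by (auto simp: vec_eq_iff restrict_coords_def coord_upd_nth)

lemma restrict_coords_orthant: "X \<in> orthant \<Longrightarrow> restrict_coords S X \<in> orthant"
  by (simp add: orthant_def restrict_coords_def)

lemma orthant_nth: "X \<in> orthant \<Longrightarrow> 0 \<le> X $ i"
  by (simp add: orthant_def)

lemma has_partial_deriv:
  assumes "partial_differentiable i f" "X \<in> orthant"
  shows "((\<lambda>t. f (coord_upd X i t)) has_vector_derivative partial_deriv i f X)
           (at (X $ i) within {0..})"
  using assms by (simp add: partial_differentiable_def partial_deriv_def vector_derivative_works)

text \<open>\<open>vector_derivative\<close> is a choice, determined only at limit points of the set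
  it is taken within. Every point of \<open>{0..}\<close> is one, the boundary point 0
  included.\<close>

lemma partial_deriv_eqI:
  assumes "X \<in> orthant"
    and "((\<lambda>t. f (coord_upd X i t)) has_vector_derivative d) (at (X $ i) within {0..})"
  shows "partial_deriv i f X = d"
  unfolding partial_deriv_def
proof (rule vector_derivative_within[OF _ assms(2)])
  have "X $ i islimpt {0..}"
    using orthant_nth[OF assms(1), of i]
      islimpt_subset[of "X $ i" "{X $ i..X $ i + 1}" "{0..}"] islimpt_Icc[of "X $ i" "X $ i + 1"]
    by auto
  then show "at (X $ i) within {0..} \<noteq> bot"
    by (simp add: trivial_limit_within)
qed

lemma partial_differentiableI:
  assumes "\<And>X. X \<in> orthant \<Longrightarrow>
    ((\<lambda>t. f (coord_upd X i t)) has_vector_derivative d X) (at (X $ i) within {0..})"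
  shows "partial_differentiable i f" and "X \<in> orthant \<Longrightarrow> partial_deriv i f X = d X"
  using assms partial_deriv_eqI[of X f i "d X"]
  by (auto simp: partial_differentiable_def has_vector_derivative_def differentiable_def)

text \<open>Zeroing the coordinates outside \<open>S\<close> commutes with substitution into a
  coordinate in \<open>S\<close>, hence with the derivatives. Equality on the orthant is enough to
  continue the induction, since one-sided derivatives there see only orthant points.\<close>

lemma partial_derivs_restrict_coords:
  assumes "partial_derivs_exist is f" "set is \<subseteq> S"
  shows "partial_derivs_exist is (\<lambda>Y. f (restrict_coords S Y)) \<and>
    (\<forall>Y\<in>orthant. partial_derivs is (\<lambda>Y. f (restrict_coords S Y)) Y =
       partial_derivs is f (restrict_coords S Y))"
  using assms
proof (induction "is")
  case (Cons i "is")
  let ?g = "partial_derivs is (\<lambda>Y. f (restrict_coords S Y))"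
  have IH: "partial_derivs_exist is (\<lambda>Y. f (restrict_coords S Y))"
    "\<And>Y. Y \<in> orthant \<Longrightarrow> ?g Y = partial_derivs is f (restrict_coords S Y)"
    using Cons by auto
  have *: "((\<lambda>t. ?g (coord_upd Y i t)) has_vector_derivative
      partial_deriv i (partial_derivs is f) (restrict_coords S Y)) (at (Y $ i) within {0..})"
    if Y: "Y \<in> orthant" for Y
  proof (rule has_vector_derivative_transform[rotated 2])
    show "((\<lambda>t. partial_derivs is f (coord_upd (restrict_coords S Y) i t)) has_vector_derivative
      partial_deriv i (partial_derivs is f) (restrict_coords S Y)) (at (Y $ i) within {0..})"
      using has_partial_deriv[OF _ restrict_coords_orthant[OF Y], of i "partial_derivs is f" S] Cons.prems
      by (simp add: restrict_coords_def)
    show "Y $ i \<in> {0..}" using orthant_nth[OF Y] by simp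
    show "?g (coord_upd Y i t) = partial_derivs is f (coord_upd (restrict_coords S Y) i t)"
      if "t \<in> {0..}" for t
      using that Cons.prems by (simp add: IH(2) coord_upd_orthant[OF Y] restrict_coords_coord_upd)
  qed
  show ?case
    using IH(1) partial_differentiableI[OF *] by simp
qed simp

section \<open>Differences in one coordinate and their products\<close>

definition coord_diff :: "real ^ 'n \<Rightarrow> 'n \<Rightarrow> (real ^ 'n \<Rightarrow> real) \<Rightarrow> real ^ 'n \<Rightarrow> real" where
  "coord_diff X i f Y = f (coord_upd Y i (X $ i)) - f (coord_upd Y i 0)"

text \<open>The head acts first, just as \<open>iterated_integral\<close> integrates over the head
  first.\<close>

primrec coord_diffs :: "real ^ 'n \<Rightarrow> 'n list \<Rightarrow> (real ^ 'n \<Rightarrow> real) \<Rightarrow> real ^ 'n \<Rightarrow> real" where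
  "coord_diffs X [] f = f"
| "coord_diffs X (i # is) f = coord_diffs X is (coord_diff X i f)"

text \<open>Substituting a constant for coordinate \<open>i\<close> commutes with varying any other
  coordinate. Membership of \<open>X\<close> in the orthant keeps the substituted points where the
  derivatives of \<open>f\<close> exist.\<close>

lemma partial_derivs_coord_diff:
  assumes X: "X \<in> orthant" and "partial_derivs_exist is f" "i \<notin> set is"
  shows "partial_derivs_exist is (coord_diff X i f) \<and>
    (\<forall>Y\<in>orthant. partial_derivs is (coord_diff X i f) Y = coord_diff X i (partial_derivs is f) Y)"
  using assms(2,3)
proof (induction "is")
  case (Cons j "is")
  let ?g = "partial_derivs is (coord_diff X i f)" and ?h = "partial_derivs is f"
  have ij: "i \<noteq> j" using Cons.prems by auto
  have IH: "partial_derivs_exist is (coord_diff X i f)"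
    "\<And>Y. Y \<in> orthant \<Longrightarrow> ?g Y = coord_diff X i ?h Y"
    using Cons by auto
  have *: "((\<lambda>t. ?g (coord_upd Y j t)) has_vector_derivative
      coord_diff X i (partial_deriv j ?h) Y) (at (Y $ j) within {0..})"
    if Y: "Y \<in> orthant" for Y
  proof (rule has_vector_derivative_transform[rotated 2])
    have D: "((\<lambda>t. ?h (coord_upd (coord_upd Y i s) j t)) has_vector_derivative
        partial_deriv j ?h (coord_upd Y i s)) (at (Y $ j) within {0..})" if "0 \<le> s" for s
      using has_partial_deriv[OF _ coord_upd_orthant[OF Y that], of j ?h i] Cons.prems ij
      by (simp add: coord_upd_nth)
    show "((\<lambda>t. ?h (coord_upd (coord_upd Y i (X $ i)) j t) - ?h (coord_upd (coord_upd Y i 0) j t))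
        has_vector_derivative coord_diff X i (partial_deriv j ?h) Y) (at (Y $ j) within {0..})"
      unfolding coord_diff_def
      by (intro has_vector_derivative_diff D orthant_nth[OF X] order_refl)
    show "Y $ j \<in> {0..}" using orthant_nth[OF Y] by simp
    show "?g (coord_upd Y j t) =
        ?h (coord_upd (coord_upd Y i (X $ i)) j t) - ?h (coord_upd (coord_upd Y i 0) j t)"
      if "t \<in> {0..}" for t
      using that by (simp add: IH(2) coord_upd_orthant[OF Y] coord_diff_def coord_upd_commute[OF ij])
  qed
  show ?case
    using IH(1) partial_differentiableI[OF *] by simp
qed simp

section \<open>Integration against the step function\<close>

lemma has_integral_partial_deriv_heaviside:
  assumes "partial_differentiable i f" and Z: "Z \<in> orthant" and X: "X \<in> orthant"
  shows "((\<lambda>t. partial_deriv i f (coord_upd Z i t) * heaviside (X $ i - t))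
           has_integral coord_diff X i f Z) {0..}"
proof -
  have "((\<lambda>t. f (coord_upd Z i t)) has_vector_derivative partial_deriv i f (coord_upd Z i t))
      (at t within {0..X $ i})" if "t \<in> {0..X $ i}" for t
    using that has_partial_deriv[OF assms(1) coord_upd_orthant[OF Z], of t i]
    by (auto intro: has_vector_derivative_within_subset)
  \<comment> \<open>For the gauge integral, the fundamental theorem also supplies the integrability
    of the derivative.\<close>
  then have "((\<lambda>t. partial_deriv i f (coord_upd Z i t)) has_integral coord_diff X i f Z) {0..X $ i}"
    unfolding coord_diff_def
    by (rule fundamental_theorem_of_calculus[OF orthant_nth[OF X]])
  \<comment> \<open>On \<open>{0..X $ i}\<close> the step function differs from 1 only at the
    endpoint, where it is 1/2; a single point is negligible.\<close>
  then have "((\<lambda>t. partial_deriv i f (coord_upd Z i t) * heaviside (X $ i - t))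
      has_integral coord_diff X i f Z) {0..X $ i}"
    by (rule has_integral_spike[where S = "{X $ i}", rotated 2]) (auto simp: heaviside_def)
  \<comment> \<open>Beyond \<open>X $ i\<close> the step function vanishes, so the integrand is its
    own extension by 0 to the half-line.\<close>
  then have "((\<lambda>t. if t \<in> {0..X $ i} then partial_deriv i f (coord_upd Z i t) * heaviside (X $ i - t)
      else 0) has_integral coord_diff X i f Z) {0..}"
    by (subst has_integral_restrict) auto
  then show ?thesis
    by (rule has_integral_eq[rotated]) (auto simp: heaviside_def)
qed

text \<open>Integrating over \<open>{0..}\<close> never leaves the orthant. Identities known only
  there, such as \<open>partial_derivs_coord_diff\<close>, can thus be used under the
  integrals.\<close>

lemma iterated_integral_cong:
  assumes "\<And>Z. Z \<in> orthant \<Longrightarrow> F Z = G Z"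
  shows "(iterated_integrable is F \<longleftrightarrow> iterated_integrable is G) \<and>
    (\<forall>Y\<in>orthant. iterated_integral is F Y = iterated_integral is G Y)"
  using assms
proof (induction "is" arbitrary: F G)
  case (Cons i "is")
  have 1: "integral {0..} (\<lambda>t. F (coord_upd Z i t)) = integral {0..} (\<lambda>t. G (coord_upd Z i t))"
    and 2: "(\<lambda>t. F (coord_upd Z i t)) integrable_on {0..} \<longleftrightarrow>
      (\<lambda>t. G (coord_upd Z i t)) integrable_on {0..}"
    if "Z \<in> orthant" for Z
    using that Cons.prems
    by (auto intro!: integral_cong integrable_cong simp: coord_upd_orthant)
  show ?case
    using Cons.IH[OF 1] 2 by simp
qed simp

text \<open>The head \<open>i\<close> is both the outermost derivative and the innermost integral.
  That integral turns the derivative into a difference; moved past the remaining derivatives, it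
  leaves the same kind of integrand for \<open>coord_diff X i f\<close> and the tail. Hence the
  induction generalizes \<open>f\<close>.\<close>

lemma iterated_integral_partial_derivs_heaviside:
  assumes X: "X \<in> orthant" and "distinct is" "partial_derivs_exist is f"
  defines "F \<equiv> \<lambda>f is \<mu>. partial_derivs is f \<mu> * (\<Prod>i\<leftarrow>is. heaviside (X $ i - \<mu> $ i))"
  shows "iterated_integrable is (F f is) \<and>
    (\<forall>Y\<in>orthant. iterated_integral is (F f is) Y = coord_diffs X is f Y)"
  using assms(2,3)
proof (induction "is" arbitrary: f)
  case Nil
  then show ?case by (simp add: F_def)
next
  case (Cons i "is")
  \<comment> \<open>Distinctness makes the remaining step factors constant in the variable of
    integration.\<close>
  have prod_upd: "(\<Prod>j\<leftarrow>is. heaviside (X $ j - coord_upd Z i t $ j)) =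
      (\<Prod>j\<leftarrow>is. heaviside (X $ j - Z $ j))" for Z t
    using Cons.prems
    by (intro arg_cong[where f = prod_list] map_cong) (auto simp: coord_upd_nth)
  have inner: "((\<lambda>t. F f (i # is) (coord_upd Z i t)) has_integral F (coord_diff X i f) is Z) {0..}"
    if Z: "Z \<in> orthant" for Z
  proof -
    have "partial_differentiable i (partial_derivs is f)" using Cons.prems by simp
    from has_integral_mult_left[OF has_integral_partial_deriv_heaviside[OF this Z X],
        of "\<Prod>j\<leftarrow>is. heaviside (X $ j - Z $ j)"]
    show ?thesis
      using Z Cons.prems partial_derivs_coord_diff[OF X, of "is" f i]
      by (simp add: F_def prod_upd mult.assoc)
  qed
  have "partial_derivs_exist is (coord_diff X i f)"
    using partial_derivs_coord_diff[OF X, of "is" f i] Cons.prems by simp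
  then show ?case
    using Cons inner
      iterated_integral_cong[of "\<lambda>Z. integral {0..} (\<lambda>t. F f (i # is) (coord_upd Z i t))"
        "F (coord_diff X i f) is" "is"]
    by (auto simp: integral_unique has_integral_integrable)
qed

section \<open>Expansion over sets of coordinates\<close>

lemma coord_diffs_cong:
  assumes "\<And>Y. (\<forall>j. j \<notin> set is \<longrightarrow> Y $ j = Z $ j) \<Longrightarrow> f Y = g Y"
  shows "coord_diffs X is f Z = coord_diffs X is g Z"
  using assms
proof (induction "is" arbitrary: f g)
  case (Cons i "is")
  show ?case
    unfolding coord_diffs.simps
    by (rule Cons.IH) (simp add: coord_diff_def Cons.prems coord_upd_nth)
qed simp

lemma coord_diff_add:
  "coord_diff X i (\<lambda>Y. f Y + g Y) = (\<lambda>Y. coord_diff X i f Y + coord_diff X i g Y)"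
  by (simp add: coord_diff_def fun_eq_iff)

lemma coord_diffs_add:
  "coord_diffs X is (\<lambda>Y. f Y + g Y) Z = coord_diffs X is f Z + coord_diffs X is g Z"
  by (induction "is" arbitrary: f g) (simp_all add: coord_diff_add)

lemma finite_strictly_sorted_lists:
  "finite A \<Longrightarrow> finite {is. sorted_wrt (<) is \<and> set is \<subseteq> (A :: 'a::linorder set)}"
  by (rule finite_subset[OF _ finite_subset_distinct[of A]]) (auto simp: strict_sorted_iff)

text \<open>Strictly sorted lists encode finite sets; the two pieces are the sets without and with
  \<open>i\<close>. As \<open>i\<close> lies below all of \<open>ls\<close>, a list containing it
  must begin with it.\<close>

lemma strictly_sorted_sublists_Cons:
  fixes i :: "'a::linorder"
  assumes "sorted_wrt (<) (i # ls)"
  shows "{is. sorted_wrt (<) is \<and> set is \<subseteq> set (i # ls)} =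
    {is. sorted_wrt (<) is \<and> set is \<subseteq> set ls} \<union>
    (#) i ` {is. sorted_wrt (<) is \<and> set is \<subseteq> set ls}" (is "?A = ?B \<union> ?C")
proof
  show "?A \<subseteq> ?B \<union> ?C"
  proof
    fix ks assume ks: "ks \<in> ?A"
    show "ks \<in> ?B \<union> ?C"
    proof (cases ks)
      case (Cons k js)
      show ?thesis
      proof (cases "k = i")
        case True
        then have "js \<in> ?B" using ks Cons by auto
        then show ?thesis using Cons True by blast
      next
        case False
        then have "i < k" using ks Cons assms by auto
        then have "i \<notin> set ks" using ks Cons by auto
        then show ?thesis using ks by auto
      qed
    qed simp
  qed
  show "?B \<union> ?C \<subseteq> ?A" using assms by (auto simp: subset_iff)
qed

text \<open>This expands the product of the operators "substitute 0, plus difference", with one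
  summand per subset of \<open>set ls\<close>. Since \<open>Y\<close> vanishes on these coordinates,
  substituting 0 there changes nothing.\<close>

lemma sum_coord_diffs:
  fixes ls :: "'n::{finite,linorder} list"
  assumes "sorted_wrt (<) ls" "\<And>i. i \<in> set ls \<Longrightarrow> Y $ i = 0"
  shows "(\<Sum>is | sorted_wrt (<) is \<and> set is \<subseteq> set ls. coord_diffs X is f Y) =
    f (\<chi> j. if j \<in> set ls then X $ j else Y $ j)"
  using assms
proof (induction ls arbitrary: f)
  case Nil
  have "{is :: 'n list. sorted_wrt (<) is \<and> set is \<subseteq> set []} = {[]}" by auto
  then show ?case by (simp del: set_empty)
next
  case (Cons i ls)
  let ?B = "{is. sorted_wrt (<) is \<and> set is \<subseteq> set ls}"
  have i: "i \<notin> set ls" using Cons.prems(1) by auto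
  let ?W = "\<chi> j. if j \<in> set ls then X $ j else Y $ j"
  have "(\<Sum>is | sorted_wrt (<) is \<and> set is \<subseteq> set (i # ls). coord_diffs X is f Y) =
      (\<Sum>is\<in>?B. coord_diffs X is f Y) + (\<Sum>is\<in>(#) i ` ?B. coord_diffs X is f Y)"
    unfolding strictly_sorted_sublists_Cons[OF Cons.prems(1)]
    by (rule sum.union_disjoint) (use i in \<open>auto intro: finite_strictly_sorted_lists\<close>)
  \<comment> \<open>Additivity merges the lists with and without head \<open>i\<close> into one sum,
    to which the induction hypothesis applies with a new function.\<close>
  also have "\<dots> = (\<Sum>is\<in>?B. coord_diffs X is (\<lambda>Y. f Y + coord_diff X i f Y) Y)"
    by (simp add: sum.reindex coord_diffs_add sum.distrib)
  also have "\<dots> = f ?W + coord_diff X i f ?W"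
    using Cons by simp
  also have "\<dots> = f (coord_upd ?W i (X $ i))"
  proof -
    \<comment> \<open>Entry 0 in position \<open>i\<close> makes the subtracted value in the
      difference cancel \<open>f ?W\<close>.\<close>
    have "?W $ i = 0" using i Cons.prems by simp
    then have "coord_upd ?W i 0 = ?W" by (metis coord_upd_triv)
    then show ?thesis by (simp add: coord_diff_def)
  qed
  also have "coord_upd ?W i (X $ i) = (\<chi> j. if j \<in> set (i # ls) then X $ j else Y $ j)"
    by (auto simp: vec_eq_iff coord_upd_nth)
  finally show ?case .
qed

text \<open>This links the hypotheses on multi-indices to the mixed derivatives of the
  decomposition, which are those of 0/1-valued multi-indices.\<close>

lemma multi_index_list_indicator:
  fixes "is" :: "'n::{finite,linorder} list"
  assumes "sorted_wrt (<) is"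
  shows "multi_index_list (\<lambda>i. of_bool (i \<in> set is)) = is"
proof -
  have "concat (map (\<lambda>i. replicate (of_bool (i \<in> set is)) i) xs) = filter (\<lambda>i. i \<in> set is) xs"
    for xs :: "'n list"
    by (induction xs) auto
  moreover have "filter (\<lambda>i. i \<in> set is) (sorted_list_of_set UNIV) = is"
    using assms by (intro strict_sorted_equal) (auto intro: sorted_wrt_filter)
  ultimately show ?thesis by (simp add: multi_index_list_def)
qed

theorem mainTheorem1:
  fixes R :: "real ^ 'n::{finite,linorder} \<Rightarrow> real"
  assumes cont: "continuous_on orthant R"
    and derivs_exist: "\<And>\<alpha>. multi_deriv_exists \<alpha> R"
    and derivs_cont: "\<And>\<alpha>. continuous_on orthant (multi_deriv \<alpha> R)"
    and derivs_integrable: "\<And>\<alpha> i X a b. X \<in> orthant \<Longrightarrow> 0 \<le> a \<Longrightarrow> a \<le> b \<Longrightarrow>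
      (\<lambda>t. multi_deriv \<alpha> R (coord_upd X i t)) integrable_on {a..b}"
    and quotients_uniform: "\<And>\<alpha> i x. 1 \<le> \<alpha> i \<Longrightarrow> 0 \<le> x \<Longrightarrow>
      uniform_limit {X \<in> orthant. X $ i = x}
        (\<lambda>h X. (multi_deriv (\<alpha>(i := \<alpha> i - 1)) R (coord_upd X i (x + h))
               - multi_deriv (\<alpha>(i := \<alpha> i - 1)) R X) / h)
        (multi_deriv \<alpha> R)
        (at 0 within {h. 0 \<le> x + h})"
  shows "\<forall>X\<in>orthant.
    (\<forall>is :: 'n list. is \<noteq> [] \<and> sorted_wrt (<) is \<longrightarrow>
        partial_derivs_exist is (\<lambda>Y. R (restrict_coords (set is) Y)) \<and>
        iterated_integrable is (step_integrand R is X)) \<and>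
    R X = R 0 +
      (\<Sum>k = 1..CARD('n). \<Sum>is | length is = k \<and> sorted_wrt (<) is.
         iterated_integral is (step_integrand R is X) 0)"
proof (intro ballI conjI allI impI; (elim conjE)?)
  fix X :: "real ^ 'n::{finite,linorder}" assume X: "X \<in> orthant"
  define g where "g is Y = R (restrict_coords (set is) Y)" for "is" Y
  have exist: "partial_derivs_exist is (g is)" if "sorted_wrt (<) is" for "is"
    using partial_derivs_restrict_coords[of "is" R "set is"] derivs_exist[of "\<lambda>i. of_bool (i \<in> set is)"]
    by (simp add: multi_index_list_indicator[OF that] g_def[abs_def])
  have integral: "iterated_integrable is (step_integrand R is X) \<and>
      (\<forall>Y\<in>orthant. iterated_integral is (step_integrand R is X) Y = coord_diffs X is (g is) Y)"
    if "sorted_wrt (<) is" for "is"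
    using iterated_integral_partial_derivs_heaviside[OF X _ exist[OF that]] that
    by (simp add: step_integrand_def[abs_def] g_def[abs_def] strict_sorted_iff)
  show "partial_derivs_exist is (\<lambda>Y. R (restrict_coords (set is) Y))"
    if "sorted_wrt (<) is" for "is"
    using exist[OF that] by (simp add: g_def[abs_def])
  show "iterated_integrable is (step_integrand R is X)" if "sorted_wrt (<) is" for "is"
    using integral[OF that] by blast

  have zero: "(0 :: real ^ 'n::{finite,linorder}) \<in> orthant" by (simp add: orthant_def)
  have eq: "iterated_integral is (step_integrand R is X) 0 = coord_diffs X is R 0"
    if "sorted_wrt (<) is" for "is"
  proof -
    have "coord_diffs X is (g is) 0 = coord_diffs X is R 0"
    \<comment> \<open>Starting from 0, the differences evaluate only at points vanishing outside
      \<open>is\<close>, which \<open>restrict_coords (set is)\<close> fixes.\<close>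
    proof (rule coord_diffs_cong)
      fix Y :: "real ^ 'n::{finite,linorder}"
      assume "\<forall>j. j \<notin> set is \<longrightarrow> Y $ j = 0 $ j"
      then have "restrict_coords (set is) Y = Y" by (simp add: vec_eq_iff restrict_coords_def)
      then show "g is Y = R Y" by (simp add: g_def)
    qed
    then show ?thesis using integral[OF that] zero by simp
  qed
  let ?S = "{is :: 'n list. sorted_wrt (<) is}"
  have fin: "finite ?S"
    using finite_strictly_sorted_lists[of "UNIV :: 'n set"] by simp
  have len: "length is \<le> CARD('n)" if "is \<in> ?S" for "is"
    using that card_mono[of UNIV "set is"] by (simp add: strict_sorted_iff distinct_card)
  \<comment> \<open>Expanding over all coordinates from the point 0 replaces every entry by that of
    \<open>X\<close>.\<close>
  have "R X = (\<Sum>is\<in>?S. coord_diffs X is R 0)"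
    using sum_coord_diffs[of "sorted_list_of_set (UNIV :: 'n set)" 0 X R] by simp
  also have "\<dots> = (\<Sum>k\<in>{0..CARD('n)}. \<Sum>is | is \<in> ?S \<and> length is = k. coord_diffs X is R 0)"
    by (rule sum.group[symmetric]) (use fin len in auto)
  also have "\<dots> = (\<Sum>is | is \<in> ?S \<and> length is = 0. coord_diffs X is R 0) +
      (\<Sum>k = 1..CARD('n). \<Sum>is | is \<in> ?S \<and> length is = k. coord_diffs X is R 0)"
    by (simp add: sum.atLeast_Suc_atMost)
  \<comment> \<open>The empty list, on which no difference is taken, gives the constant term
    \<open>R 0\<close>.\<close>
  also have "{is \<in> ?S. length is = 0} = {[]}" by auto
  finally show "R X = R 0 +
      (\<Sum>k = 1..CARD('n). \<Sum>is | length is = k \<and> sorted_wrt (<) is.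
         iterated_integral is (step_integrand R is X) 0)"
    by (simp add: eq conj_commute cong: conj_cong)
qed

end
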